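(* Let $h \geq 2$ and let $f$ be a function such that $f(n)$ is a positive integer for every nonnegative integer $n$. There exists a set $A$ of nonnegative integers (a basis of order $h$) with $r_A(n,h) = f(n)$ for all $n \geq 0$ if and only if for every $N$ there exists a finite set $A_N$ of nonnegative integers with $\max(A_N) \geq N$ and $r_{A_N}(n,h) = f(n)$ for all $n = 0, 1,\ldots,\max(A_N)$.
   Context: For a set $A$ of nonnegative integers, a nonnegative integer $n$ and a positive integer $h$, $r_A(n,h)$ denotes the number of representations $n = a_1 + \cdots + a_h$ with $a_1,\ldots,a_h \in A$ and $a_1 \leq a_2 \leq \cdots \leq a_h$. A set $A$ of nonnegative integers is a basis of order $h$ if $r_A(n,h)\ge 1$ for every nonnegative integer $n$. *)

theory Defs
  imports Main
begin

(* The nondecreasing tuples a_1 <= ... <= a_h are the sorted lists of length h.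
   There are only finitely many with sum n, even for infinite A, so card does not
   collapse to its default value 0 on infinite sets. *)
definition rep_count :: "nat set \<Rightarrow> nat \<Rightarrow> nat \<Rightarrow> nat" where
  "rep_count A n h =
     card {as. length as = h \<and> set as \<subseteq> A \<and> sorted as \<and> sum_list as = n}"

definition basis_of_order :: "nat set \<Rightarrow> nat \<Rightarrow> bool" where
  "basis_of_order A h \<longleftrightarrow> (\<forall>n. rep_count A n h \<ge> 1)"

end

(* A representation of n uses only elements of A that are at most n, so r_A(n,h) depends only
   on the part of A below n + 1.  Truncating A at one of its elements gives the finite sets;
   conversely, the compactness of the space of subsets of the naturals turns a sequence of
   finite sets that work on ever longer intervals into one set that works everywhere. *)
theory Submission
  imports Defs "HOL-Library.Infinite_Set"
begin

lemma rep_count_cong: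
  assumes "A \<inter> {..n} = B \<inter> {..n}"
  shows "rep_count A n h = rep_count B n h"
proof -
  have "set as \<subseteq> A \<longleftrightarrow> set as \<subseteq> B" if "sum_list as = n" for as
  proof -
    have "set as \<subseteq> {..n}"
      using that member_le_sum_list by fastforce
    with assms show ?thesis by blast
  qed
  then show ?thesis
    unfolding rep_count_def by (intro arg_cong[where f = card]) blast
qed

text \<open>If \<open>m\<close> bounds \<open>A\<close>, then \<open>h\<close> summands from
  \<open>A\<close> add up to at most \<open>h * m\<close>, so \<open>Suc (h * m)\<close> has no
  representation.\<close>

lemma infinite_if_basis_of_order:
  assumes "basis_of_order A h"
  shows "infinite A"
proof
  assume "finite A"
  then obtain m where m: "\<And>a. a \<in> A \<Longrightarrow> a \<le> m"
    using finite_nat_set_iff_bounded_le by auto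
  have "rep_count A (Suc (h * m)) h \<noteq> 0"
    using assms by (simp add: basis_of_order_def Suc_le_eq)
  then obtain as where as: "length as = h" "set as \<subseteq> A" "sum_list as = Suc (h * m)"
    unfolding rep_count_def by (auto simp: card_eq_0_iff)
  have "sum_list as \<le> length as * m"
    using as(2) m sum_list_mono[of as "\<lambda>x. x" "\<lambda>_. m"] by (auto simp: sum_list_triv)
  with as show False by simp
qed

(* Koenig's lemma for the binary tree of initial segments: S m is an initial segment shared by
   infinitely many members of the sequence. *)
lemma ex_limit_set:
  fixes B :: "nat \<Rightarrow> nat set"
  shows "\<exists>A. \<forall>m. \<exists>N\<ge>m. A \<inter> {..<m} = B N \<inter> {..<m}"
proof -
  define good where "good m S \<longleftrightarrow> infinite {N. B N \<inter> {..<m} = S}" for m S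
  have "\<exists>S. \<forall>m. good m (S m) \<and> S (Suc m) \<inter> {..<m} = S m"
  proof (rule dependent_nat_choice)
    show "\<exists>S. good 0 S" by (intro exI[of _ "{}"]) (simp add: good_def)
  next
    fix S m assume "good m S"
    \<comment> \<open>A segment has only two possible extensions, according to whether
      \<open>m\<close> is in \<open>B N\<close>. Two finite sets cannot cover an infinite one, so at
      least one extension is again good.\<close>
    have "{N. B N \<inter> {..<m} = S} \<subseteq>
        {N. B N \<inter> {..<Suc m} = S} \<union> {N. B N \<inter> {..<Suc m} = insert m S}"
      by (auto simp: lessThan_Suc)
    then have "good (Suc m) S \<or> good (Suc m) (insert m S)"
      using \<open>good m S\<close> unfolding good_def by (meson finite_UnI finite_subset)
    moreover have "S \<subseteq> {..<m}"
      using \<open>good m S\<close> not_finite_existsD unfolding good_def by blast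
    then have "S \<inter> {..<m} = S" "insert m S \<inter> {..<m} = S" by auto
    ultimately show "\<exists>T. good (Suc m) T \<and> T \<inter> {..<m} = S" by blast
  qed
  then obtain S where S: "\<And>m. good m (S m)" "\<And>m. S (Suc m) \<inter> {..<m} = S m"
    by blast
  \<comment> \<open>The segment at level \<open>Suc m\<close> is the first one that decides
    \<open>m\<close>; by coherence, later segments never revise the decision.\<close>
  define A where "A = {m. m \<in> S (Suc m)}"
  have A: "A \<inter> {..<m} = S m" for m
  proof (induction m)
    case 0
    show ?case using S(2)[of 0] by simp
  next
    case (Suc m)
    have "S (Suc m) \<subseteq> {..<Suc m}"
      using S(1)[of "Suc m"] not_finite_existsD unfolding good_def by blast
    then have "S (Suc m) = (S (Suc m) \<inter> {..<m}) \<union> (A \<inter> {m})"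
      by (auto simp: A_def lessThan_Suc)
    also have "\<dots> = (A \<inter> {..<m}) \<union> (A \<inter> {m})"
      by (simp only: S(2) Suc)
    finally show ?case by (auto simp: lessThan_Suc)
  qed
  have "\<exists>N\<ge>m. A \<inter> {..<m} = B N \<inter> {..<m}" for m
  proof -
    \<comment> \<open>Infinitely many indices share \<open>S m\<close>, so one of them can be chosen
      as large as \<open>m\<close>.\<close>
    obtain N where "N \<ge> m" "B N \<inter> {..<m} = S m"
      using S(1)[of m] by (auto simp: good_def infinite_nat_iff_unbounded_le)
    with A show ?thesis by auto
  qed
  then show ?thesis by blast
qed

theorem theorem5:
  fixes h :: nat and f :: "nat \<Rightarrow> nat"
  assumes "h \<ge> 2"
    and "\<And>n. f n > 0"
  shows "(\<exists>A :: nat set. basis_of_order A h \<and> (\<forall>n. rep_count A n h = f n)) \<longleftrightarrow>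
         (\<forall>N :: nat. \<exists>B :: nat set. finite B \<and> B \<noteq> {} \<and> Max B \<ge> N \<and>
            (\<forall>n \<le> Max B. rep_count B n h = f n))"
proof
  assume "\<exists>A. basis_of_order A h \<and> (\<forall>n. rep_count A n h = f n)"
  then obtain A where A: "basis_of_order A h" "\<And>n. rep_count A n h = f n"
    by blast
  show "\<forall>N. \<exists>B. finite B \<and> B \<noteq> {} \<and> Max B \<ge> N \<and> (\<forall>n \<le> Max B. rep_count B n h = f n)"
  proof
    fix N
    obtain a where a: "a \<in> A" "a \<ge> N"
      using infinite_if_basis_of_order[OF A(1)] by (auto simp: infinite_nat_iff_unbounded_le)
    \<comment> \<open>The cut is made at an element of \<open>A\<close> so that the maximum is
      exactly \<open>a\<close>; a cut at \<open>N\<close> itself could leave a maximum below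
      \<open>N\<close>.\<close>
    have "Max (A \<inter> {..a}) = a"
      using a by (intro Max_eqI) auto
    moreover have "rep_count (A \<inter> {..a}) n h = f n" if "n \<le> a" for n
      using that by (subst A(2)[symmetric], intro rep_count_cong) auto
    ultimately show "\<exists>B. finite B \<and> B \<noteq> {} \<and> Max B \<ge> N \<and> (\<forall>n \<le> Max B. rep_count B n h = f n)"
      using a by (intro exI[of _ "A \<inter> {..a}"]) auto
  qed
next
  assume "\<forall>N. \<exists>B. finite B \<and> B \<noteq> {} \<and> Max B \<ge> N \<and> (\<forall>n \<le> Max B. rep_count B n h = f n)"
  then have "\<forall>N. \<exists>B. \<forall>n\<le>N. rep_count B n h = f n"
    by (meson order_trans)
  then obtain B where B: "\<And>N n. n \<le> N \<Longrightarrow> rep_count (B N) n h = f n"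
    by metis
  obtain A where A: "\<And>m. \<exists>N\<ge>m. A \<inter> {..<m} = B N \<inter> {..<m}"
    using ex_limit_set by blast
  have "rep_count A n h = f n" for n
  proof -
    \<comment> \<open>Level \<open>Suc n\<close> makes the agreement include \<open>n\<close>
      itself, and the bound on \<open>N\<close> puts \<open>n\<close> in the range where
      \<open>B N\<close> has the right count.\<close>
    obtain N where "N \<ge> Suc n" "A \<inter> {..n} = B N \<inter> {..n}"
      using A[of "Suc n"] unfolding lessThan_Suc_atMost by blast
    then show ?thesis
      using B[of n N] rep_count_cong[of A n "B N" h] by simp
  qed
  moreover from this have "basis_of_order A h"
    using assms(2) unfolding basis_of_order_def by (simp add: Suc_leI)
  ultimately show "\<exists>A. basis_of_order A h \<and> (\<forall>n. rep_count A n h = f n)" by blast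
qed

end
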